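(* Let $G=(V,E)$ be a finite graph with maximum degree at most $\Delta$, where $\Delta\ge1$, and let $\mathbf A_G$ be its adjacency matrix. Set $\lambda^\star=-\lambda_{\min}(\mathbf A_G)$, and suppose that $q\ge3$, $0<B<1$, and $$\lambda^\star(1-B)B^{1-\Delta}<1 .$$ Then the embedded antiferromagnetic Potts measure $\mu_{G,B}$ is $\delta$-ULC with $$\delta=1-\lambda^\star(1-B)B^{1-\Delta}.$$
   Context: The $q$-state Potts measure on $G$ with parameter $B$ is $\mu_{G,B}(\sigma)\propto B^{m_G(\sigma)}$, $\sigma\in[q]^V$, where $[q]=\{1,\dots,q\}$ and $m_G(\sigma)=|\{vw\in E:\sigma_v=\sigma_w\}|$ is the number of monochromatic edges. Embedding: define the injective map $\varphi:[q]^V\to\mathbb N^{V\times[q-1]}$ by $\varphi(\sigma)_{v,k}=\mathbf 1_{\{\sigma_v=k\}}$ for $v\in V$, $k\in[q-1]$ (so color $q$ at $v$ is represented by the zero vector). Its image is $\{\mathbf x\in\{0,1\}^{V\times[q-1]}:\sum_{k=1}^{q-1}x_{v,k}\le1\ \forall v\in V\}$, which is downward closed. The embedded measure, still denoted $\mu_{G,B}$, is the pushforward of the Potts measure under $\varphi$, viewed as a probability measure on $\mathbb N^{V\times[q-1]}$. $\delta$-ULC: for a finite index set $J$, a set $S\subseteq\mathbb N^J$ is downward closed if $\mathbf n\in S$ and $\mathbf 0\le\mathbf m\le\mathbf n$ (coordinatewise) imply $\mathbf m\in S$. A probability measure $\mu$ on $\mathbb N^J$ with downward closed support is $\delta$-ULC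 ($\delta>0$) if, with $\mathbf n!=\prod_{i\in J}n_i!$, $a(\mathbf n)=\mathbf n!\,\mu(\mathbf n)$, $\mathbf e_i$ the standard basis vectors, and $\mathcal I_{\mathbf n}=\{i\in J:\mathbf n+\mathbf e_i\in\mathrm{supp}(\mu)\}$, for every $\mathbf n\in\mathrm{supp}(\mu)$ the matrix $$\Big(1-\frac{a(\mathbf n)\,a(\mathbf n+\mathbf e_i+\mathbf e_j)}{a(\mathbf n+\mathbf e_i)\,a(\mathbf n+\mathbf e_j)}\Big)_{i,j\in\mathcal I_{\mathbf n}}+(1-\delta)\,\mathrm{diag}\Big(\frac{a(\mathbf n)}{a(\mathbf n+\mathbf e_i)}\Big)_{i\in\mathcal I_{\mathbf n}}$$ is positive semidefinite. *)

theory Defs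
  imports "HOL-Probability.Probability"
begin

section \<open>Graphs\<close>

text \<open>
  A finite simple graph is given by a finite vertex type and a set of edges, each edge being a
  set of exactly two vertices. Since types are nonempty, the adjacency matrix has at least one
  row, so that its smallest eigenvalue makes sense.
\<close>

definition simple_graph :: "'v::finite set set \<Rightarrow> bool" where
  "simple_graph E \<longleftrightarrow> (\<forall>e\<in>E. card e = 2)"

definition vertex_degree :: "'v::finite set set \<Rightarrow> 'v \<Rightarrow> nat" where
  "vertex_degree E v = card {e \<in> E. v \<in> e}"

definition adjacency_matrix :: "'v::finite set set \<Rightarrow> real^'v^'v" where
  "adjacency_matrix E = (\<chi> v w. if {v, w} \<in> E then 1 else 0)"

definition eigenvalue :: "real^'n^'n \<Rightarrow> real \<Rightarrow> bool" where
  "eigenvalue A c \<longleftrightarrow> (\<exists>x. x \<noteq> 0 \<and> A *v x = c *s x)"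

text \<open>Only meaningful for symmetric matrices, whose set of real eigenvalues is finite and nonempty.\<close>

definition lambda_min :: "real^'n^'n \<Rightarrow> real" where
  "lambda_min A = Min {c. eigenvalue A c}"


section \<open>The Potts measure and its embedding\<close>

definition colourings :: "nat \<Rightarrow> ('v::finite \<Rightarrow> nat) set" where
  "colourings q = UNIV \<rightarrow> {1..q}"

definition mono_edges :: "'v::finite set set \<Rightarrow> ('v \<Rightarrow> nat) \<Rightarrow> nat" where
  "mono_edges E \<sigma> = card {e \<in> E. \<forall>v\<in>e. \<forall>w\<in>e. \<sigma> v = \<sigma> w}"

definition partition_function :: "nat \<Rightarrow> 'v::finite set set \<Rightarrow> real \<Rightarrow> real" where
  "partition_function q E B = (\<Sum>\<sigma>\<in>colourings q. B ^ mono_edges E \<sigma>)"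

text \<open>
  The weights form a probability mass function whenever \<open>B > 0\<close> and \<open>q \<ge> 1\<close>; see
  \<open>pmf_potts\<close> below.
\<close>

definition potts :: "nat \<Rightarrow> 'v::finite set set \<Rightarrow> real \<Rightarrow> ('v \<Rightarrow> nat) pmf" where
  "potts q E B = embed_pmf (\<lambda>\<sigma>.
     if \<sigma> \<in> colourings q then B ^ mono_edges E \<sigma> / partition_function q E B else 0)"

lemma finite_colourings: "finite (colourings q :: ('v::finite \<Rightarrow> nat) set)"
  using finite_PiE[of "UNIV :: 'v set" "\<lambda>_. {1..q}"] by (simp add: colourings_def PiE_UNIV_domain)

lemma pmf_potts:
  assumes "B > 0" "q \<ge> 1"
  shows "pmf (potts q E B) \<sigma> =
    (if \<sigma> \<in> colourings q then B ^ mono_edges E \<sigma> / partition_function q E B else 0)"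
proof -
  let ?f = "\<lambda>\<sigma>. if \<sigma> \<in> colourings q
    then B ^ mono_edges E \<sigma> / partition_function q E B else (0::real)"
  have "(\<lambda>_. 1) \<in> (colourings q :: ('a \<Rightarrow> nat) set)"
    using assms by (simp add: colourings_def)
  then have Z: "partition_function q E B > 0"
    unfolding partition_function_def using assms
    by (intro sum_pos finite_colourings) auto
  then have nonneg: "?f \<sigma> \<ge> 0" for \<sigma>
    using assms by simp
  have nonneg': "B ^ mono_edges E \<sigma> / partition_function q E B \<ge> 0" for \<sigma>
    using Z assms by simp
  have "(\<integral>\<^sup>+ \<sigma>. ennreal (?f \<sigma>) \<partial>count_space UNIV) = (\<Sum>\<sigma>\<in>colourings q. ennreal (?f \<sigma>))"
    by (intro nn_integral_count_space' finite_colourings) auto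
  also have "\<dots> = ennreal (\<Sum>\<sigma>\<in>colourings q. ?f \<sigma>)"
    using nonneg' by (intro sum_ennreal) auto
  also have "(\<Sum>\<sigma>\<in>colourings q. ?f \<sigma>) = 1"
    using Z by (simp add: partition_function_def flip: sum_divide_distrib)
  finally show ?thesis
    unfolding potts_def using nonneg' by (subst pmf_embed_pmf) auto
qed

text \<open>
  The space \<open>\<nat>\<^sup>J\<close> is represented by the functions on the whole index type that vanish outside
  \<open>J\<close>. Colour \<open>q\<close> at \<open>v\<close> is represented by zeros in all coordinates \<open>(v, k)\<close>.
\<close>

definition vectors :: "'i set \<Rightarrow> ('i \<Rightarrow> nat) set" where
  "vectors J = {n. \<forall>i. i \<notin> J \<longrightarrow> n i = 0}"

definition potts_index :: "nat \<Rightarrow> ('v::finite \<times> nat) set" where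
  "potts_index q = UNIV \<times> {1..q - 1}"

definition potts_embedding :: "nat \<Rightarrow> ('v::finite \<Rightarrow> nat) \<Rightarrow> ('v \<times> nat \<Rightarrow> nat)" where
  "potts_embedding q \<sigma> = (\<lambda>(v, k). if k \<in> {1..q - 1} \<and> \<sigma> v = k then 1 else 0)"

definition embedded_potts :: "nat \<Rightarrow> 'v::finite set set \<Rightarrow> real \<Rightarrow> ('v \<times> nat \<Rightarrow> nat) pmf" where
  "embedded_potts q E B = map_pmf (potts_embedding q) (potts q E B)"


section \<open>The ULC property\<close>

definition downward_closed :: "('i \<Rightarrow> nat) set \<Rightarrow> bool" where
  "downward_closed S \<longleftrightarrow> (\<forall>n\<in>S. \<forall>m. (\<forall>i. m i \<le> n i) \<longrightarrow> m \<in> S)"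

definition psd_on :: "'i set \<Rightarrow> ('i \<Rightarrow> 'i \<Rightarrow> real) \<Rightarrow> bool" where
  "psd_on I M \<longleftrightarrow> (\<forall>i\<in>I. \<forall>j\<in>I. M i j = M j i) \<and>
     (\<forall>x. 0 \<le> (\<Sum>i\<in>I. \<Sum>j\<in>I. x i * M i j * x j))"

definition add_unit :: "('i \<Rightarrow> nat) \<Rightarrow> 'i \<Rightarrow> ('i \<Rightarrow> nat)" where
  "add_unit n i = n(i := n i + 1)"

definition weight :: "'i set \<Rightarrow> ('i \<Rightarrow> nat) pmf \<Rightarrow> ('i \<Rightarrow> nat) \<Rightarrow> real" where
  "weight J \<mu> n = (\<Prod>i\<in>J. fact (n i)) * pmf \<mu> n"

definition extensions :: "'i set \<Rightarrow> ('i \<Rightarrow> nat) pmf \<Rightarrow> ('i \<Rightarrow> nat) \<Rightarrow> 'i set" where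
  "extensions J \<mu> n = {i \<in> J. add_unit n i \<in> set_pmf \<mu>}"

definition ulc_matrix ::
    "'i set \<Rightarrow> real \<Rightarrow> ('i \<Rightarrow> nat) pmf \<Rightarrow> ('i \<Rightarrow> nat) \<Rightarrow> 'i \<Rightarrow> 'i \<Rightarrow> real" where
  "ulc_matrix J \<delta> \<mu> n i j =
     (1 - weight J \<mu> n * weight J \<mu> (add_unit (add_unit n i) j) /
          (weight J \<mu> (add_unit n i) * weight J \<mu> (add_unit n j)))
     + (1 - \<delta>) * (if i = j then weight J \<mu> n / weight J \<mu> (add_unit n i) else 0)"

definition ulc :: "'i set \<Rightarrow> real \<Rightarrow> ('i \<Rightarrow> nat) pmf \<Rightarrow> bool" where
  "ulc J \<delta> \<mu> \<longleftrightarrow> finite J \<and> \<delta> > 0 \<and> set_pmf \<mu> \<subseteq> vectors J \<and> downward_closed (set_pmf \<mu>) \<and>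
     (\<forall>n\<in>set_pmf \<mu>. psd_on (extensions J \<mu> n) (ulc_matrix J \<delta> \<mu> n))"

end

theory Submission
  imports Defs
begin

text \<open>
  At a configuration \<open>n = \<phi>(\<sigma>)\<close> the extensions are the pairs \<open>(v, k)\<close> with \<open>\<sigma> v = q\<close>, and with
  \<open>U = {v. \<sigma> v = q}\<close> the ULC matrix becomes
  \<open>(I + (1 - B) A\<^sub>U) \<otimes> J + B (1 - B) A\<^sub>U \<otimes> I + (1 - \<delta>) D\<close>, where \<open>J\<close> is the all-ones matrix and the
  entries of the diagonal matrix \<open>D\<close> are at least \<open>B ^ \<Delta>\<close>. As \<open>A\<^sub>U \<ge> - \<lambda>\<^sup>\<star>\<close>, the first
  summand is positive semidefinite because \<open>\<lambda>\<^sup>\<star> (1 - B) < B ^ (\<Delta> - 1) \<le> 1\<close>, and the sum of the other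
  two because \<open>(1 - \<delta>) B ^ \<Delta> = \<lambda>\<^sup>\<star> B (1 - B)\<close>.
\<close>

section \<open>The smallest eigenvalue of a symmetric matrix\<close>

lemma symmetric_inner_commute:
  fixes A :: "real^'n^'n"
  assumes "transpose A = A"
  shows "x \<bullet> (A *v y) = (A *v x) \<bullet> y"
  by (metis assms dot_lmul_matrix vector_transpose_matrix)

text \<open>Eigenvectors for distinct eigenvalues of a symmetric matrix are orthogonal, so choosing
  one per eigenvalue gives an independent set. Finiteness is what lets the \<open>Min\<close> in
  \<open>lambda_min\<close> be compared with a given eigenvalue.\<close>

lemma finite_eigenvalues_symmetric:
  fixes A :: "real^'n^'n"
  assumes "transpose A = A"
  shows "finite {c. eigenvalue A c}"
proof -
  define f where "f c = (SOME x. x \<noteq> 0 \<and> A *v x = c *s x)" for c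
  have f: "f c \<noteq> 0" "A *v f c = c *s f c" if "eigenvalue A c" for c
    using someI_ex[OF that[unfolded eigenvalue_def]] by (auto simp: f_def)
  have orth: "f c \<bullet> f d = 0" if "eigenvalue A c" "eigenvalue A d" "c \<noteq> d" for c d
  proof -
    have "d * (f c \<bullet> f d) = c * (f c \<bullet> f d)"
      using symmetric_inner_commute[OF assms, of "f c" "f d"] f that
      by (simp add: scalar_mult_eq_scaleR)
    then show ?thesis using that by simp
  qed
  have inj: "inj_on f {c. eigenvalue A c}"
    by (rule inj_onI) (metis f(1) inner_eq_zero_iff mem_Collect_eq orth)
  have "pairwise orthogonal (f ` {c. eigenvalue A c})"
    unfolding pairwise_def orthogonal_def using orth by auto
  then have "independent (f ` {c. eigenvalue A c})"
    using f by (intro pairwise_orthogonal_independent) auto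
  then have "finite (f ` {c. eigenvalue A c})"
    by (rule independent_imp_finite)
  then show ?thesis using inj finite_imageD by blast
qed

text \<open>By compactness the quadratic form attains its minimum \<open>m\<close> on the unit
  sphere, and a minimiser is an eigenvector for \<open>m\<close>. Homogeneity extends the bound from
  the sphere to all vectors.\<close>

lemma ex_eigenvalue_Rayleigh:
  fixes A :: "real^'n^'n"
  assumes sym: "transpose A = A"
  obtains m where "eigenvalue A m" "\<And>x. m * (x \<bullet> x) \<le> x \<bullet> (A *v x)"
proof -
  have cont: "continuous_on (sphere 0 1) (\<lambda>x. x \<bullet> (A *v x))"
    by (intro continuous_intros matrix_vector_mult_linear_continuous_on)
  have "sphere (0::real^'n) 1 \<noteq> {}" by simp
  then obtain u where u: "norm u = 1" and umin: "\<And>x. norm x = 1 \<Longrightarrow> u \<bullet> (A *v u) \<le> x \<bullet> (A *v x)"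
    using continuous_attains_inf[OF compact_sphere _ cont] by auto
  define m where "m = u \<bullet> (A *v u)"
  have ray: "m * (x \<bullet> x) \<le> x \<bullet> (A *v x)" for x
  proof (cases "x = 0")
    case False
    define y where "y = (1 / norm x) *\<^sub>R x"
    have "norm y = 1" using False by (simp add: y_def)
    then have "m \<le> y \<bullet> (A *v y)" using umin by (simp add: m_def)
    also have "\<dots> = (x \<bullet> (A *v x)) / (norm x)\<^sup>2"
      by (simp add: y_def scaleR_matrix_vector_assoc[symmetric] matrix_vector_mult_scaleR power2_eq_square)
    finally show ?thesis using False by (simp add: field_simps dot_square_norm)
  qed simp
  define w where "w = A *v u - m *\<^sub>R u"
  define g where "g = w \<bullet> (A *v w) - m * (w \<bullet> w)"
  \<comment> \<open>Perturbing the minimiser \<open>u\<close> in the direction \<open>- w\<close> decreases the form to first order unless \<open>w = 0\<close>.\<close>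
  have pert: "2 * s * (w \<bullet> w) \<le> s\<^sup>2 * g" for s
  proof -
    have 1: "(u - s *\<^sub>R w) \<bullet> (A *v (u - s *\<^sub>R w))
        = m - 2 * s * (w \<bullet> (A *v u)) + s\<^sup>2 * (w \<bullet> (A *v w))"
      using symmetric_inner_commute[OF sym, of u w]
      by (simp add: m_def inner_commute power2_eq_square algebra_simps)
    have 2: "(u - s *\<^sub>R w) \<bullet> (u - s *\<^sub>R w) = 1 - 2 * s * (w \<bullet> u) + s\<^sup>2 * (w \<bullet> w)"
      using u by (simp add: inner_commute power2_eq_square algebra_simps norm_eq_1)
    \<comment> \<open>With this identity the first-order part of the form minus \<open>m\<close>
      times the squared norm is exactly \<open>- 2 * s * (w \<bullet> w)\<close>.\<close>
    have 3: "w \<bullet> w = w \<bullet> (A *v u) - m * (w \<bullet> u)"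
      by (simp add: w_def inner_diff_right)
    have 4: "2 * s * (w \<bullet> w) = 2 * s * (w \<bullet> (A *v u)) - 2 * s * (m * (w \<bullet> u))"
      by (subst 3) (simp add: algebra_simps)
    show ?thesis
      using ray[of "u - s *\<^sub>R w"] 4 unfolding 1 2 g_def by (simp add: algebra_simps)
  qed
  have "w \<bullet> w \<le> 0"
  proof (rule ccontr)
    assume "\<not> w \<bullet> w \<le> 0"
    then have pos: "w \<bullet> w > 0" by (rule not_le_imp_less)
    \<comment> \<open>Taking \<open>s = 1\<close> forces \<open>g > 0\<close>. Then
      \<open>s = w \<bullet> w / g\<close>, the minimiser of the quadratic bound up to a factor 2,
      turns \<open>pert\<close> into 2t \<le> t for a positive t.\<close>
    have gpos: "g > 0" using order.strict_trans2[OF pos, of g] pert[of 1] pos by (simp del: inner_gt_zero_iff)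
    have "2 * (w \<bullet> w / g) * (w \<bullet> w) \<le> (w \<bullet> w / g)\<^sup>2 * g" by (rule pert)
    also have "\<dots> = (w \<bullet> w / g) * (w \<bullet> w)" using gpos by (simp add: power2_eq_square)
    finally show False using mult_pos_pos[OF divide_pos_pos[OF pos gpos] pos] by simp
  qed
  then have "w = 0" by (metis inner_gt_zero_iff not_le)
  then have "A *v u = m *s u" by (simp add: w_def scalar_mult_eq_scaleR)
  moreover have "u \<noteq> 0" using u by auto
  ultimately have "eigenvalue A m" unfolding eigenvalue_def by blast
  then show ?thesis using ray that by blast
qed

lemma lambda_min_Rayleigh:
  fixes A :: "real^'n^'n"
  assumes "transpose A = A"
  shows "lambda_min A * (x \<bullet> x) \<le> x \<bullet> (A *v x)"
proof -
  obtain m where m: "eigenvalue A m" "\<And>x. m * (x \<bullet> x) \<le> x \<bullet> (A *v x)"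
    using ex_eigenvalue_Rayleigh[OF assms] by blast
  have "lambda_min A \<le> m"
    unfolding lambda_min_def using m finite_eigenvalues_symmetric[OF assms] by (intro Min_le) auto
  then show ?thesis using m(2)[of x] mult_right_mono[of "lambda_min A" m "x \<bullet> x"] by simp
qed

lemma transpose_adjacency_matrix: "transpose (adjacency_matrix E) = adjacency_matrix E"
  by (simp add: transpose_def adjacency_matrix_def vec_eq_iff insert_commute)

lemma simple_graph_no_loop: "simple_graph E \<Longrightarrow> {v} \<notin> E"
  by (auto simp: simple_graph_def)

text \<open>Extending \<open>f\<close> by zero outside \<open>U\<close> turns the form of the
  principal submatrix on \<open>U\<close> into that of the whole matrix, so the eigenvalue of the
  whole graph controls every induced subgraph.\<close>

lemma adjacency_form_ge:
  fixes E :: "'v::finite set set" and f :: "'v \<Rightarrow> real"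
  shows "lambda_min (adjacency_matrix E) * (\<Sum>v\<in>U. (f v)\<^sup>2)
    \<le> (\<Sum>v\<in>U. \<Sum>w\<in>U. f v * (if {v, w} \<in> E then 1 else 0) * f w)"
proof -
  define x :: "real^'v" where "x = (\<chi> v. if v \<in> U then f v else 0)"
  have "x \<bullet> x = (\<Sum>v\<in>U. (f v)\<^sup>2)"
    by (simp add: inner_vec_def x_def power2_eq_square if_distrib sum.If_cases cong: if_cong)
  moreover have "x \<bullet> (adjacency_matrix E *v x)
      = (\<Sum>v\<in>UNIV. \<Sum>w\<in>UNIV. x $ v * (if {v, w} \<in> E then 1 else 0) * x $ w)"
    by (simp add: inner_vec_def matrix_vector_mult_def adjacency_matrix_def sum_distrib_left mult.assoc)
  moreover have "\<dots> = (\<Sum>v\<in>U. \<Sum>w\<in>U. x $ v * (if {v, w} \<in> E then 1 else 0) * x $ w)"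
    by (subst sum.mono_neutral_right[of UNIV U]; (intro sum.cong sum.mono_neutral_right)?)
      (auto simp: x_def)
  moreover have "\<dots> = (\<Sum>v\<in>U. \<Sum>w\<in>U. f v * (if {v, w} \<in> E then 1 else 0) * f w)"
    by (intro sum.cong) (auto simp: x_def)
  ultimately show ?thesis
    using lambda_min_Rayleigh[OF transpose_adjacency_matrix[of E], of x] by simp
qed

text \<open>The test vector is the indicator of one vertex; its form value is a diagonal entry,
  which vanishes as there are no loops.\<close>

lemma lambda_min_adjacency_le_0:
  assumes "simple_graph (E :: 'v::finite set set)"
  shows "lambda_min (adjacency_matrix E) \<le> 0"
  using adjacency_form_ge[of E "\<lambda>_. 1" "{undefined}"] simple_graph_no_loop[OF assms] by simp

section \<open>Recolouring and monochromatic edges\<close>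

definition colour_degree :: "'v::finite set set \<Rightarrow> ('v \<Rightarrow> nat) \<Rightarrow> 'v \<Rightarrow> nat \<Rightarrow> nat" where
  "colour_degree E \<sigma> v k = card {w. {v, w} \<in> E \<and> \<sigma> w = k}"

lemma colour_degree_le:
  "colour_degree E \<sigma> v k \<le> vertex_degree E v"
  unfolding colour_degree_def vertex_degree_def
  by (rule card_inj_on_le[of "\<lambda>w. {v, w}"]) (auto simp: inj_on_def doubleton_eq_iff)

text \<open>Only the second summand depends on the colour of \<open>v\<close>, which isolates the
  effect of recolouring \<open>v\<close>.\<close>

lemma mono_edges_split:
  assumes "simple_graph E"
  shows "mono_edges E \<sigma> = card {e \<in> E. v \<notin> e \<and> (\<forall>x\<in>e. \<forall>y\<in>e. \<sigma> x = \<sigma> y)}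
    + colour_degree E \<sigma> v (\<sigma> v)"
proof -
  let ?P = "\<lambda>e. \<forall>x\<in>e. \<forall>y\<in>e. \<sigma> x = \<sigma> y"
  have "{e \<in> E. v \<in> e \<and> ?P e} = (\<lambda>w. {v, w}) ` {w. {v, w} \<in> E \<and> \<sigma> w = \<sigma> v}"
  proof (intro equalityI subsetI)
    fix e assume "e \<in> {e \<in> E. v \<in> e \<and> ?P e}"
    then have e: "e \<in> E" "v \<in> e" and mono: "?P e" by blast+
    obtain a b where "e = {a, b}" using e(1) assms by (auto simp: simple_graph_def card_2_iff)
    then obtain w where w: "e = {v, w}" using e(2) by auto
    then have "\<sigma> w = \<sigma> v" using mono by blast
    then show "e \<in> (\<lambda>w. {v, w}) ` {w. {v, w} \<in> E \<and> \<sigma> w = \<sigma> v}" using e(1) w by simp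
  qed auto
  moreover have "inj_on (\<lambda>w. {v, w}) {w. {v, w} \<in> E \<and> \<sigma> w = \<sigma> v}"
    by (auto simp: inj_on_def doubleton_eq_iff)
  ultimately have "card {e \<in> E. v \<in> e \<and> ?P e} = colour_degree E \<sigma> v (\<sigma> v)"
    by (simp add: colour_degree_def card_image)
  moreover have "{e \<in> E. ?P e} = {e \<in> E. v \<notin> e \<and> ?P e} \<union> {e \<in> E. v \<in> e \<and> ?P e}" by blast
  then have "mono_edges E \<sigma> = card {e \<in> E. v \<notin> e \<and> ?P e} + card {e \<in> E. v \<in> e \<and> ?P e}"
    unfolding mono_edges_def by (simp only:) (rule card_Un_disjoint; blast intro: finite)
  ultimately show ?thesis by simp
qed

text \<open>The additive form avoids truncated subtraction: the left indicator accounts for the old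
  colour of \<open>v\<close>, the right one for the new colour.\<close>

lemma colour_degree_upd:
  "colour_degree E (\<sigma>(v := k)) w l + (if {v, w} \<in> E \<and> \<sigma> v = l then 1 else 0)
    = colour_degree E \<sigma> w l + (if {v, w} \<in> E \<and> k = l then 1 else 0)"
proof -
  let ?R = "{x. {w, x} \<in> E \<and> \<sigma> x = l \<and> x \<noteq> v}"
  have "{x. {w, x} \<in> E \<and> (\<sigma>(v := k)) x = l} = (if {v, w} \<in> E \<and> k = l then insert v ?R else ?R)"
    "{x. {w, x} \<in> E \<and> \<sigma> x = l} = (if {v, w} \<in> E \<and> \<sigma> v = l then insert v ?R else ?R)"
    by (auto simp: insert_commute)
  then show ?thesis by (simp add: colour_degree_def)
qed

lemma mono_edges_upd:
  assumes "simple_graph E"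
  shows "mono_edges E (\<sigma>(v := k)) + colour_degree E \<sigma> v (\<sigma> v)
    = mono_edges E \<sigma> + colour_degree E \<sigma> v k"
proof -
  have "{e \<in> E. v \<notin> e \<and> (\<forall>x\<in>e. \<forall>y\<in>e. (\<sigma>(v := k)) x = (\<sigma>(v := k)) y)}
      = {e \<in> E. v \<notin> e \<and> (\<forall>x\<in>e. \<forall>y\<in>e. \<sigma> x = \<sigma> y)}"
    by (intro Collect_cong conj_cong refl ball_cong) (auto simp: fun_upd_other)
  moreover have "colour_degree E (\<sigma>(v := k)) v k = colour_degree E \<sigma> v k"
    using colour_degree_upd[of E \<sigma> v k v k] simple_graph_no_loop[OF assms, of v] by simp
  ultimately show ?thesis
    using mono_edges_split[OF assms, of \<sigma> v] mono_edges_split[OF assms, of "\<sigma>(v := k)" v] by simp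
qed

text \<open>Recolouring \<open>v\<close> first changes the effect of recolouring \<open>w\<close>
  only through the edge between them: \<open>w\<close> has lost one neighbour of colour
  \<open>q\<close>, and has gained one of colour \<open>l\<close> if \<open>k = l\<close>.\<close>

lemma mono_edges_upd2:
  assumes G: "simple_graph E" and "v \<noteq> w" "\<sigma> v = q" "\<sigma> w = q" "k \<noteq> q" "l \<noteq> q"
  shows "mono_edges E \<sigma> + mono_edges E (\<sigma>(v := k, w := l))
    = mono_edges E (\<sigma>(v := k)) + mono_edges E (\<sigma>(w := l))
      + (if {v, w} \<in> E then if k = l then 2 else 1 else 0)"
  using mono_edges_upd[OF G, of \<sigma> w l] mono_edges_upd[OF G, of "\<sigma>(v := k)" w l]
    colour_degree_upd[of E \<sigma> v k w q] colour_degree_upd[of E \<sigma> v k w l] assms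
  by (auto split: if_splits)

section \<open>The embedded measure\<close>

lemma potts_embedding_apply:
  "potts_embedding q \<sigma> (v, k) = (if k \<in> {1..q - 1} \<and> \<sigma> v = k then 1 else 0)"
  by (simp add: potts_embedding_def)

lemma colouringsD: "\<sigma> \<in> colourings q \<Longrightarrow> 1 \<le> \<sigma> v \<and> \<sigma> v \<le> q"
  by (auto simp: colourings_def Pi_iff)

lemma colourings_upd: "\<sigma> \<in> colourings q \<Longrightarrow> 1 \<le> k \<Longrightarrow> k \<le> q \<Longrightarrow> \<sigma>(v := k) \<in> colourings q"
  by (auto simp: colourings_def Pi_iff)

lemma inj_on_potts_embedding: "inj_on (potts_embedding q) (colourings q)"
proof (rule inj_onI, rule ext)
  fix \<sigma> \<tau> :: "'v::finite \<Rightarrow> nat" and v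
  assume c: "\<sigma> \<in> colourings q" "\<tau> \<in> colourings q"
    and eq: "potts_embedding q \<sigma> = potts_embedding q \<tau>"
  have "potts_embedding q \<sigma> (v, k) = potts_embedding q \<tau> (v, k)" for k by (simp add: eq)
  \<comment> \<open>Colour \<open>q\<close> has no coordinate, so both colours are tested: if they
    differ, at least one is below \<open>q\<close> and its coordinate tells them apart.\<close>
  from this[of "\<sigma> v"] this[of "\<tau> v"] show "\<sigma> v = \<tau> v"
    using colouringsD[OF c(1), of v] colouringsD[OF c(2), of v]
    by (auto simp: potts_embedding_apply split: if_splits)
qed

lemma add_unit_embedding:
  assumes "\<sigma> v = q" "k \<in> {1..q - 1}"
  shows "add_unit (potts_embedding q \<sigma>) (v, k) = potts_embedding q (\<sigma>(v := k))"
  using assms by (auto simp: add_unit_def potts_embedding_apply fun_eq_iff)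

text \<open>If \<open>v\<close> had a colour below \<open>q\<close>, the added unit would produce an
  entry 2 or a second nonzero entry at \<open>v\<close>, neither of which occurs in the
  image.\<close>

lemma add_unit_embedding_in_image:
  assumes \<sigma>: "\<sigma> \<in> colourings q" and k: "k \<in> {1..q - 1}"
    and "add_unit (potts_embedding q \<sigma>) (v, k) \<in> potts_embedding q ` colourings q"
  shows "\<sigma> v = q"
proof (rule ccontr)
  assume "\<sigma> v \<noteq> q"
  then have r: "\<sigma> v \<in> {1..q - 1}" using colouringsD[OF \<sigma>, of v] by auto
  obtain \<tau> where "add_unit (potts_embedding q \<sigma>) (v, k) = potts_embedding q \<tau>" using assms(3) by auto
  then have "add_unit (potts_embedding q \<sigma>) (v, k) (v, l) = potts_embedding q \<tau> (v, l)" for l by simp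
  from this[of k] this[of "\<sigma> v"] show False
    using r k by (auto simp: add_unit_def potts_embedding_apply split: if_splits)
qed

lemma partition_function_pos:
  assumes "B > 0" "q \<ge> 1"
  shows "partition_function q (E :: 'v::finite set set) B > 0"
proof -
  have "(\<lambda>_. 1) \<in> (colourings q :: ('v \<Rightarrow> nat) set)" using assms by (simp add: colourings_def)
  then show ?thesis
    unfolding partition_function_def using assms by (intro sum_pos finite_colourings) auto
qed

lemma set_pmf_potts:
  assumes "B > 0" "q \<ge> 1"
  shows "set_pmf (potts q E B) = colourings q"
  using partition_function_pos[OF assms, of E] assms by (auto simp: set_pmf_iff pmf_potts split: if_splits)

lemma set_pmf_embedded_potts:
  assumes "B > 0" "q \<ge> 1"
  shows "set_pmf (embedded_potts q E B) = potts_embedding q ` colourings q"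
  by (simp add: embedded_potts_def set_pmf_potts[OF assms])

text \<open>Embedded vectors have entries 0 and 1, so all factorials equal 1.\<close>

lemma weight_embedded_potts:
  assumes "B > 0" "q \<ge> 1" "\<sigma> \<in> colourings q"
  shows "weight J (embedded_potts q E B) (potts_embedding q \<sigma>)
    = B ^ mono_edges E \<sigma> / partition_function q E B"
proof -
  have "(\<Prod>i\<in>J. fact (potts_embedding q \<sigma> i) :: real) = 1"
    by (intro prod.neutral) (auto simp: potts_embedding_apply)
  moreover have "pmf (embedded_potts q E B) (potts_embedding q \<sigma>) = pmf (potts q E B) \<sigma>"
    unfolding embedded_potts_def using assms inj_on_potts_embedding
    by (intro pmf_map_inj) (auto simp: set_pmf_potts)
  ultimately show ?thesis using assms by (simp add: weight_def pmf_potts)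
qed

lemma weight_eq_0: "n \<notin> set_pmf \<mu> \<Longrightarrow> weight J \<mu> n = 0"
  by (simp add: weight_def set_pmf_iff)

lemma downward_closed_potts_embedding:
  assumes "q \<ge> 1"
  shows "downward_closed (potts_embedding q ` colourings q)"
  unfolding downward_closed_def
proof (intro ballI allI impI)
  fix n m :: "'v::finite \<times> nat \<Rightarrow> nat"
  assume "n \<in> potts_embedding q ` colourings q" and le: "\<forall>i. m i \<le> n i"
  then obtain \<sigma> where \<sigma>: "\<sigma> \<in> colourings q" "n = potts_embedding q \<sigma>" by auto
  \<comment> \<open>Lowering a coordinate from 1 to 0 means recolouring that vertex with
    \<open>q\<close>.\<close>
  define \<tau> where "\<tau> v = (if m (v, \<sigma> v) = 0 then q else \<sigma> v)" for v
  have "\<tau> \<in> colourings q" using \<sigma> assms by (auto simp: \<tau>_def colourings_def Pi_iff)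
  moreover have "m (v, k) = potts_embedding q \<tau> (v, k)" for v k
  proof -
    have "m (v, k) \<le> potts_embedding q \<sigma> (v, k)" using le \<sigma> by blast
    then show ?thesis
      by (auto simp: potts_embedding_apply \<tau>_def split: if_splits)
  qed
  then have "m = potts_embedding q \<tau>" by auto
  ultimately show "m \<in> potts_embedding q ` colourings q" by blast
qed

lemma extensions_embedded_potts:
  assumes "B > 0" "q \<ge> 1" "\<sigma> \<in> colourings q"
  shows "extensions (potts_index q) (embedded_potts q E B) (potts_embedding q \<sigma>)
    = {v. \<sigma> v = q} \<times> {1..q - 1}"
proof -
  have "add_unit (potts_embedding q \<sigma>) (v, k) \<in> potts_embedding q ` colourings q \<longleftrightarrow> \<sigma> v = q"
    if "k \<in> {1..q - 1}" for v k
  proof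
    assume "\<sigma> v = q"
    moreover have "\<sigma>(v := k) \<in> colourings q" using colourings_upd[OF assms(3)] that by auto
    ultimately show "add_unit (potts_embedding q \<sigma>) (v, k) \<in> potts_embedding q ` colourings q"
      by (simp only: add_unit_embedding[OF _ that] image_eqI)
  qed (rule add_unit_embedding_in_image[OF assms(3) that])
  then show ?thesis
    by (simp add: extensions_def potts_index_def set_pmf_embedded_potts[OF assms(1,2)] set_eq_iff
        conj_commute cong: conj_cong)
qed

text \<open>The partition function cancels in all ratios. Across an edge the entry is 1 -
  \<open>B\<close> for different colours and 1 - \<open>B ^ 2\<close> = (1 - \<open>B\<close>) +
  \<open>B\<close> (1 - \<open>B\<close>) for equal ones; this splitting separates the all-ones
  colour block from the identity block.\<close>

lemma ulc_matrix_embedded_potts: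
  assumes G: "simple_graph E" and B: "B > 0" and q: "q \<ge> 1" and \<sigma>: "\<sigma> \<in> colourings q"
    and v: "\<sigma> v = q" and w: "\<sigma> w = q" and k: "k \<in> {1..q - 1}" and l: "l \<in> {1..q - 1}"
  shows "ulc_matrix J \<delta> (embedded_potts q E B) (potts_embedding q \<sigma>) (v, k) (w, l)
    = (if v = w then 1 else 0)
      + (if {v, w} \<in> E then 1 else 0) * ((1 - B) + (if k = l then B * (1 - B) else 0))
      + (1 - \<delta>) * (if v = w \<and> k = l
          then B ^ colour_degree E \<sigma> v q / B ^ colour_degree E \<sigma> v k else 0)"
proof -
  let ?Z = "partition_function q E B"
  let ?\<mu> = "embedded_potts q E B"
  let ?n = "potts_embedding q \<sigma>"
  have Z: "?Z > 0" by (rule partition_function_pos[OF B q])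
  have cv: "\<sigma>(v := k) \<in> colourings q" using colourings_upd[OF \<sigma>] k by auto
  have cw: "\<sigma>(w := l) \<in> colourings q" using colourings_upd[OF \<sigma>] l by auto
  note W = weight_embedded_potts[OF B q]
  have nv: "add_unit ?n (v, k) = potts_embedding q (\<sigma>(v := k))" by (rule add_unit_embedding[of \<sigma> v q k, OF v k])
  have nw: "add_unit ?n (w, l) = potts_embedding q (\<sigma>(w := l))" by (rule add_unit_embedding[of \<sigma> w q l, OF w l])
  have diag: "weight J ?\<mu> ?n / weight J ?\<mu> (add_unit ?n (v, k))
      = B ^ colour_degree E \<sigma> v q / B ^ colour_degree E \<sigma> v k"
  proof -
    have "B ^ mono_edges E (\<sigma>(v := k)) * B ^ colour_degree E \<sigma> v q
        = B ^ mono_edges E \<sigma> * B ^ colour_degree E \<sigma> v k"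
      using mono_edges_upd[OF G, of \<sigma> v k] v by (simp flip: power_add)
    then show ?thesis unfolding nv W[OF \<sigma>] W[OF cv] using B Z by (simp add: field_simps)
  qed
  have off: "1 - weight J ?\<mu> ?n * weight J ?\<mu> (add_unit (add_unit ?n (v, k)) (w, l))
      / (weight J ?\<mu> (add_unit ?n (v, k)) * weight J ?\<mu> (add_unit ?n (w, l)))
      = (if v = w then 1 else 0)
      + (if {v, w} \<in> E then 1 else 0) * ((1 - B) + (if k = l then B * (1 - B) else 0))"
  proof (cases "v = w")
    case True
    \<comment> \<open>A vertex cannot be extended twice, so the numerator vanishes and the entry is
      1 for all pairs of colours.\<close>
    have "(\<sigma>(v := k)) w \<noteq> q" using True k by auto
    then have "add_unit (add_unit ?n (v, k)) (w, l) \<notin> set_pmf ?\<mu>"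
      unfolding nv set_pmf_embedded_potts[OF B q]
      using add_unit_embedding_in_image[OF cv l, of w] by blast
    then show ?thesis using True simple_graph_no_loop[OF G] by (simp add: weight_eq_0)
  next
    case False
    let ?s = "if {v, w} \<in> E then if k = l then 2 else 1 else (0::nat)"
    have nvw: "add_unit (add_unit ?n (v, k)) (w, l) = potts_embedding q (\<sigma>(v := k, w := l))"
      unfolding nv using False w by (intro add_unit_embedding l) auto
    have cvw: "\<sigma>(v := k, w := l) \<in> colourings q" using colourings_upd[OF cv] l by auto
    have kl: "k \<noteq> q" "l \<noteq> q" using k l by auto
    have "B ^ mono_edges E \<sigma> * B ^ mono_edges E (\<sigma>(v := k, w := l))
        = B ^ mono_edges E (\<sigma>(v := k)) * B ^ mono_edges E (\<sigma>(w := l)) * B ^ ?s"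
      using mono_edges_upd2[where \<sigma> = \<sigma>, OF G False v w kl] by (simp only: flip: power_add)
    then have ratio: "weight J ?\<mu> ?n * weight J ?\<mu> (potts_embedding q (\<sigma>(v := k, w := l)))
        / (weight J ?\<mu> (potts_embedding q (\<sigma>(v := k))) * weight J ?\<mu> (potts_embedding q (\<sigma>(w := l))))
        = B ^ ?s"
      unfolding W[OF \<sigma>] W[OF cv] W[OF cw] W[OF cvw] using B Z by (simp add: field_simps)
    show ?thesis
      unfolding nvw unfolding nv nw ratio using False by (simp add: power2_eq_square algebra_simps)
  qed
  show ?thesis
    unfolding ulc_matrix_def off using diag by auto
qed

section \<open>Positive semidefiniteness\<close>

text \<open>All-ones colour blocks see \<open>x\<close> only through its colour sums
  \<open>y\<close>, whereas identity blocks decouple the colours. The bound on the adjacency form is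
  therefore applied once to \<open>y\<close> and once for each colour.\<close>

lemma kronecker_form_nonneg:
  fixes E :: "'v::finite set set" and x :: "'v \<times> nat \<Rightarrow> real"
  defines "s \<equiv> - lambda_min (adjacency_matrix E)"
  assumes B: "0 < B" "B < 1" and lam: "s * (1 - B) \<le> 1" and K: "finite K"
    and D: "\<And>v k. v \<in> U \<Longrightarrow> k \<in> K \<Longrightarrow> s * (B * (1 - B)) \<le> D v k"
  shows "0 \<le> (\<Sum>i\<in>U \<times> K. \<Sum>j\<in>U \<times> K. x i * ((if fst i = fst j then 1 else 0)
      + (if {fst i, fst j} \<in> E then 1 else 0) * ((1 - B) + (if snd i = snd j then B * (1 - B) else 0))
      + (if fst i = fst j \<and> snd i = snd j then D (fst i) (snd i) else 0)) * x j)" (is "0 \<le> ?S")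
proof -
  define a :: "'v \<Rightarrow> 'v \<Rightarrow> real" where "a v w = (if {v, w} \<in> E then 1 else 0)" for v w
  define y where "y v = (\<Sum>k\<in>K. x (v, k))" for v
  have "?S = (\<Sum>v\<in>U. \<Sum>k\<in>K. \<Sum>w\<in>U. \<Sum>l\<in>K. x (v, k) * ((if v = w then 1 else 0)
      + a v w * ((1 - B) + (if k = l then B * (1 - B) else 0))
      + (if v = w \<and> k = l then D v k else 0)) * x (w, l))"
    by (simp add: sum.cartesian_product' a_def cong: if_cong)
  also have "\<dots> = (\<Sum>v\<in>U. \<Sum>k\<in>K. \<Sum>w\<in>U. \<Sum>l\<in>K.
        (if v = w then x (v, k) * x (w, l) else 0)
      + (1 - B) * (x (v, k) * a v w * x (w, l))
      + (if k = l then B * (1 - B) * (x (v, k) * a v w * x (w, l)) else 0)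
      + (if v = w then if k = l then D v k * (x (v, k))\<^sup>2 else 0 else 0))"
    by (intro sum.cong refl) (auto simp: algebra_simps power2_eq_square)
  \<comment> \<open>In order: identity with all-ones blocks, adjacency with all-ones blocks,
    adjacency with identity blocks, and the diagonal.\<close>
  also have "\<dots> = (\<Sum>v\<in>U. \<Sum>k\<in>K. \<Sum>w\<in>U. \<Sum>l\<in>K. if v = w then x (v, k) * x (w, l) else 0)
      + (\<Sum>v\<in>U. \<Sum>k\<in>K. \<Sum>w\<in>U. \<Sum>l\<in>K. (1 - B) * (x (v, k) * a v w * x (w, l)))
      + (\<Sum>v\<in>U. \<Sum>k\<in>K. \<Sum>w\<in>U. \<Sum>l\<in>K.
          if k = l then B * (1 - B) * (x (v, k) * a v w * x (w, l)) else 0)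
      + (\<Sum>v\<in>U. \<Sum>k\<in>K. \<Sum>w\<in>U. \<Sum>l\<in>K. if v = w then if k = l then D v k * (x (v, k))\<^sup>2 else 0 else 0)"
    (is "_ = ?S1 + ?S2 + ?S3 + ?S4")
    by (simp add: sum.distrib)
  finally have S: "?S = ?S1 + ?S2 + ?S3 + ?S4" .
  \<comment> \<open>Pulls the test \<open>v = w\<close> out of the sum over \<open>l\<close>, so
    that the sum over \<open>w\<close> collapses.\<close>
  have if_sum: "(\<Sum>l\<in>K. if P then f l else 0) = (if P then \<Sum>l\<in>K. f l else (0::real))" for P f
    by simp
  have S1: "?S1 = (\<Sum>v\<in>U. (y v)\<^sup>2)"
    by (intro sum.cong refl)
      (simp add: if_sum y_def power2_eq_square sum_product)
  have S2: "?S2 = (1 - B) * (\<Sum>v\<in>U. \<Sum>w\<in>U. y v * a v w * y w)"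
  proof -
    have "(\<Sum>k\<in>K. \<Sum>w\<in>U. \<Sum>l\<in>K. (1 - B) * (x (v, k) * a v w * x (w, l)))
        = (\<Sum>w\<in>U. (1 - B) * (y v * a v w * y w))" for v
      by (subst sum.swap) (simp add: y_def sum_distrib_left sum_distrib_right mult_ac)
    then show ?thesis by (simp add: sum_distrib_left)
  qed
  have S3: "?S3 = B * (1 - B) * (\<Sum>k\<in>K. \<Sum>v\<in>U. \<Sum>w\<in>U. x (v, k) * a v w * x (w, k))"
    using K by (subst sum.swap) (simp add: sum_distrib_left)
  have S4: "?S4 = (\<Sum>v\<in>U. \<Sum>k\<in>K. D v k * (x (v, k))\<^sup>2)"
    by (intro sum.cong refl) (use K in \<open>simp add: if_sum\<close>)
  have "0 \<le> (1 - s * (1 - B)) * (\<Sum>v\<in>U. (y v)\<^sup>2)"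
    using lam by (intro mult_nonneg_nonneg sum_nonneg) auto
  also have "\<dots> \<le> ?S1 + ?S2"
    using mult_left_mono[OF adjacency_form_ge[of E y U], of "1 - B"] B
    unfolding S1 S2 unfolding s_def a_def by (simp add: algebra_simps)
  finally have p1: "0 \<le> ?S1 + ?S2" .
  have "- (s * (B * (1 - B))) * (\<Sum>k\<in>K. \<Sum>v\<in>U. (x (v, k))\<^sup>2) \<le> ?S3"
  proof -
    \<comment> \<open>For each fixed colour \<open>k\<close>, the adjacency bound is applied to the
      slice of \<open>x\<close> at \<open>k\<close>.\<close>
    have "(\<Sum>k\<in>K. - s * (\<Sum>v\<in>U. (x (v, k))\<^sup>2)) \<le> (\<Sum>k\<in>K. \<Sum>v\<in>U. \<Sum>w\<in>U. x (v, k) * a v w * x (w, k))"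
      unfolding s_def a_def using adjacency_form_ge[of E "\<lambda>v. x (v, k)" U for k] by (intro sum_mono) simp
    then have "B * (1 - B) * (\<Sum>k\<in>K. - s * (\<Sum>v\<in>U. (x (v, k))\<^sup>2)) \<le> ?S3"
      unfolding S3 using B by (intro mult_left_mono) auto
    then show ?thesis by (simp add: sum_negf mult_ac flip: sum_distrib_left)
  qed
  moreover have "s * (B * (1 - B)) * (\<Sum>k\<in>K. \<Sum>v\<in>U. (x (v, k))\<^sup>2) \<le> ?S4"
    unfolding S4 by (subst sum.swap) (auto simp: sum_distrib_left intro!: sum_mono mult_right_mono D)
  ultimately have "0 \<le> ?S3 + ?S4" by simp
  with p1 show ?thesis unfolding S by simp
qed

theorem theorem6p6:
  fixes E :: "'v::finite set set" and \<Delta> q :: nat and B lstar :: real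
  assumes "simple_graph E"
    and "\<Delta> \<ge> 1" and "\<forall>v. vertex_degree E v \<le> \<Delta>"
    and "lstar = - lambda_min (adjacency_matrix E)"
    and "q \<ge> 3" and "0 < B" and "B < 1"
    and "lstar * (1 - B) * B powi (1 - int \<Delta>) < 1"
  shows "ulc (potts_index q) (1 - lstar * (1 - B) * B powi (1 - int \<Delta>)) (embedded_potts q E B)"
proof -
  note G = assms(1) and B = assms(6,7)
  have q: "q \<ge> 1" using assms(5) by simp
  let ?J = "potts_index q :: ('v \<times> nat) set" and ?\<mu> = "embedded_potts q E B"
  define c where "c = lstar * (1 - B) * B powi (1 - int \<Delta>)"
  have l0: "lstar \<ge> 0" using lambda_min_adjacency_le_0[OF G] assms(4) by simp
  \<comment> \<open>The exponents add up to 1, which gives \<open>cB\<close>: the diagonal lower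
    bound \<open>c * B ^ \<Delta>\<close> is exactly the amount that the adjacency term with
    identity blocks can lose.\<close>
  have "B powi (1 - int \<Delta>) * B ^ \<Delta> = B powi (1 - int \<Delta> + int \<Delta>)"
    using B by (subst power_int_add) auto
  then have "B powi (1 - int \<Delta>) * B ^ \<Delta> = B" by simp
  then have cB: "c * B ^ \<Delta> = lstar * (B * (1 - B))"
    unfolding c_def by (metis mult.assoc mult.commute)
  have c0: "c \<ge> 0" unfolding c_def using l0 B by auto
  have "1 \<le> B powi (1 - int \<Delta>)"
  proof -
    \<comment> \<open>The natural subtraction is exact because \<Delta> \<ge> 1.\<close>
    have "1 - int \<Delta> = - int (\<Delta> - 1)" using assms(2) by simp
    then have "B powi (1 - int \<Delta>) = inverse (B ^ (\<Delta> - 1))"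
      by (simp only: power_int_minus power_int_of_nat)
    then show ?thesis using B by (simp add: one_le_inverse power_le_one)
  qed
  then have lam: "lstar * (1 - B) \<le> 1"
    using assms(8) mult_left_mono[of 1 "B powi (1 - int \<Delta>)" "lstar * (1 - B)"] l0 B by simp
  have "psd_on (extensions ?J ?\<mu> n) (ulc_matrix ?J (1 - c) ?\<mu> n)" if n_in: "n \<in> set_pmf ?\<mu>" for n
  proof -
    obtain \<sigma> where \<sigma>: "\<sigma> \<in> colourings q" and n: "n = potts_embedding q \<sigma>"
      using n_in unfolding set_pmf_embedded_potts[OF B(1) q] by auto
    define U where "U = {v. \<sigma> v = q}"
    define D where "D v k = c * (B ^ colour_degree E \<sigma> v q / B ^ colour_degree E \<sigma> v k)" for v k
    define N where "N i j = (if fst i = fst j then 1 else 0)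
      + (if {fst i, fst j} \<in> E then 1 else 0) * ((1 - B) + (if snd i = snd j then B * (1 - B) else 0))
      + (if fst i = fst j \<and> snd i = snd j then D (fst i) (snd i) else 0)" for i j :: "'v \<times> nat"
    have ext: "extensions ?J ?\<mu> n = U \<times> {1..q - 1}"
      unfolding n U_def by (rule extensions_embedded_potts[OF B(1) q \<sigma>])
    have M: "ulc_matrix ?J (1 - c) ?\<mu> n i j = N i j"
      if "i \<in> U \<times> {1..q - 1}" "j \<in> U \<times> {1..q - 1}" for i j
      using that ulc_matrix_embedded_potts[OF G B(1) q \<sigma>, of "fst i" "fst j" "snd i" "snd j"]
      by (cases i; cases j) (auto simp: n N_def D_def U_def)
    have D_ge: "lstar * (B * (1 - B)) \<le> D v k" for v k
    proof -
      have "B ^ \<Delta> \<le> B ^ colour_degree E \<sigma> v q"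
        using order.trans[OF colour_degree_le[of E \<sigma> v q]] assms(3) B by (intro power_decreasing) auto
      \<comment> \<open>The denominator is a power of \<open>B\<close> and hence at most 1, so
        dividing by it cannot decrease the value.\<close>
      also have "\<dots> \<le> B ^ colour_degree E \<sigma> v q / B ^ colour_degree E \<sigma> v k"
        using B by (simp add: le_divide_eq power_le_one mult_left_le)
      finally show ?thesis
        unfolding D_def cB[symmetric] using c0 by (rule mult_left_mono)
    qed
    have "0 \<le> (\<Sum>i\<in>U \<times> {1..q - 1}. \<Sum>j\<in>U \<times> {1..q - 1}. x i * N i j * x j)" for x
      unfolding N_def using D_ge lam assms(4) by (intro kronecker_form_nonneg B) auto
    moreover have "N i j = N j i" for i j by (auto simp: N_def insert_commute)
    ultimately show ?thesis unfolding psd_on_def ext using M by simp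
  qed
  moreover have "set_pmf ?\<mu> \<subseteq> vectors ?J"
    unfolding set_pmf_embedded_potts[OF B(1) q]
    by (auto simp: vectors_def potts_index_def potts_embedding_apply)
  moreover have "downward_closed (set_pmf ?\<mu>)"
    unfolding set_pmf_embedded_potts[OF B(1) q] by (rule downward_closed_potts_embedding[OF q])
  moreover have "finite ?J" by (simp add: potts_index_def)
  ultimately show ?thesis using assms(8) unfolding ulc_def c_def by simp
qed

end
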